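(* Let $X$ be a non-empty separable metric space. Then the infimum in the definition of the topological Hausdorff dimension is attained: $$\dim_{tH} X=\min\{d: X \text{ has a basis } \mathcal{U} \text{ such that } \dim_{H} \partial U \leq d-1 \text{ for every } U\in \mathcal{U}\}.$$
   Context: $\dim_H$ denotes Hausdorff dimension, with the convention $\dim_H\emptyset=-1$. The topological Hausdorff dimension is defined by $\dim_{tH}\emptyset=-1$ and, for a non-empty metric space $X$, $\dim_{tH}X=\inf\{d: X \text{ has a basis } \mathcal U \text{ of open sets such that } \dim_H\partial U\le d-1 \text{ for every } U\in\mathcal U\}$. With the convention $\infty-1=\infty$, the value $d=\infty$ always belongs to this set, and $\min\{\infty\}=\infty$. *)

theory Defs
  imports "HOL-Analysis.Analysis"
begin

text \<open>The gauge \<open>(diam U)\<^sup>s\<close>, with the conventions that the empty set contributes \<open>0\<close> and that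
  \<open>(diam U)\<^sup>0 = 1\<close> for non-empty \<open>U\<close>, even if \<open>diam U = 0\<close> (note that \<open>0 powr 0 = 0\<close>
  in the library).\<close>

definition diam_pow :: "real \<Rightarrow> 'a::metric_space set \<Rightarrow> ennreal" where
  "diam_pow s U = (if U = {} then 0 else if s = 0 then 1 else ennreal (diameter U powr s))"

text \<open>Boundedness of the covering sets is required explicitly because \<open>diameter\<close> is real-valued and
  unspecified on unbounded sets. Finite covers are sequences that are eventually empty.\<close>

definition hausdorff_premeasure :: "real \<Rightarrow> real \<Rightarrow> 'a::metric_space set \<Rightarrow> ennreal" where
  "hausdorff_premeasure s \<delta> A =
     (INF U \<in> {U :: nat \<Rightarrow> 'a set. A \<subseteq> (\<Union>i. U i) \<and> (\<forall>i. bounded (U i) \<and> diameter (U i) \<le> \<delta>)}.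
        \<Sum>i. diam_pow s (U i))"

text \<open>The supremum is the limit as \<open>\<delta>\<close> tends to \<open>0\<close> from the right, by monotonicity in \<open>\<delta>\<close>.\<close>

definition hausdorff_measure :: "real \<Rightarrow> 'a::metric_space set \<Rightarrow> ennreal" where
  "hausdorff_measure s A = (SUP \<delta> \<in> {0<..}. hausdorff_premeasure s \<delta> A)"

definition hausdorff_dim :: "'a::metric_space set \<Rightarrow> ereal" where
  "hausdorff_dim A =
     (if A = {} then - 1 else (INF s \<in> {s. 0 \<le> s \<and> hausdorff_measure s A = 0}. ereal s))"

definition topology_basis :: "'a topology \<Rightarrow> 'a set set \<Rightarrow> bool" where
  "topology_basis T \<U> \<longleftrightarrow>
     (\<forall>U\<in>\<U>. openin T U) \<and> (\<forall>V. openin T V \<longrightarrow> (\<exists>\<V>\<subseteq>\<U>. \<Union>\<V> = V))"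

text \<open>Metric spaces are represented as subsets \<open>X\<close> of a metric space type, with the subspace topology;
  boundaries are taken relative to \<open>X\<close>. The bounds \<open>d\<close> range over the extended reals, where
  \<open>\<infinity> - 1 = \<infinity>\<close>.\<close>

definition tH_bounds :: "'a::metric_space set \<Rightarrow> ereal set" where
  "tH_bounds X = {d. \<exists>\<U>. topology_basis (top_of_set X) \<U> \<and>
     (\<forall>U\<in>\<U>. hausdorff_dim ((top_of_set X) frontier_of U) \<le> d - 1)}"

definition topological_hausdorff_dim :: "'a::metric_space set \<Rightarrow> ereal" where
  "topological_hausdorff_dim X = (if X = {} then - 1 else Inf (tH_bounds X))"

end

theory Submission
  imports Defs
begin

text \<open>If the infimum \<open>d\<close> is infinite there is nothing to do, and if \<open>d < 1\<close> some basis has empty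
  frontiers, since a non-empty set has non-negative Hausdorff dimension. Otherwise take, for each
  \<open>n\<close>, a countable basis whose frontiers have dimension less than \<open>s n = d - 1 + 1/(n+1)\<close>. The union
  of these frontiers is null for the \<open>s n\<close>-dimensional Hausdorff measure, hence contained in a null
  \<open>G\<^sub>\<delta>\<close> set \<open>G n\<close>. Let \<open>G\<close> be the intersection of the \<open>G n\<close>; its dimension is at most \<open>d - 1\<close>. The
  complement of \<open>G\<close> in \<open>X\<close> is a countable union of closed sets, each of which is avoided by the
  frontiers of some basis, so by the argument of the countable sum theorem there is a single basis
  whose frontiers avoid all of them, that is, lie in \<open>G\<close>.\<close>

section \<open>Null sets of the Hausdorff measure\<close>

lemma suminf_half_powers: "0 \<le> e \<Longrightarrow> (\<Sum>i. ennreal (e * (1/2) ^ Suc i)) = ennreal e"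
  using sums_mult[OF power_half_series, of e] by (intro suminf_ennreal_eq) simp_all

text \<open>A supremum in \<open>ennreal\<close> vanishes iff every term does, and an infimum
  vanishes iff arbitrarily small values occur. With both operators eliminated, null sets are handled
  below by explicit covers.\<close>

lemma hausdorff_measure_eq_0_iff:
  "hausdorff_measure s A = 0 \<longleftrightarrow>
     (\<forall>\<delta>>0. \<forall>e>0. \<exists>U :: nat \<Rightarrow> 'a::metric_space set. A \<subseteq> (\<Union>i. U i) \<and>
        (\<forall>i. bounded (U i) \<and> diameter (U i) \<le> \<delta>) \<and> (\<Sum>i. diam_pow s (U i)) \<le> ennreal e)"
    (is "_ \<longleftrightarrow> ?R")
proof -
  let ?C = "\<lambda>\<delta>. {U :: nat \<Rightarrow> 'a set. A \<subseteq> (\<Union>i. U i) \<and> (\<forall>i. bounded (U i) \<and> diameter (U i) \<le> \<delta>)}"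
  have "hausdorff_measure s A = 0 \<longleftrightarrow> (\<forall>\<delta>>0. hausdorff_premeasure s \<delta> A = 0)"
    using SUP_bot_conv(1)[of "\<lambda>\<delta>. hausdorff_premeasure s \<delta> A" "{0<..}"]
    by (simp add: hausdorff_measure_def bot_ennreal Ball_def)
  also have "\<dots> \<longleftrightarrow> ?R"
  proof (intro iffI allI impI)
    fix \<delta> e :: real
    assume null: "\<forall>\<delta>>0. hausdorff_premeasure s \<delta> A = 0" and "0 < \<delta>" "0 < e"
    then have "(INF U\<in>?C \<delta>. \<Sum>i. diam_pow s (U i)) < ennreal e"
      by (simp add: hausdorff_premeasure_def)
    then show "\<exists>U. A \<subseteq> (\<Union>i. U i) \<and> (\<forall>i. bounded (U i) \<and> diameter (U i) \<le> \<delta>) \<and>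
        (\<Sum>i. diam_pow s (U i)) \<le> ennreal e"
      unfolding INF_less_iff using less_imp_le by blast
  next
    fix \<delta> :: real
    assume R: ?R and "0 < \<delta>"
    have "hausdorff_premeasure s \<delta> A \<le> 0"
    proof (rule ennreal_le_epsilon)
      fix e :: real assume "0 < e"
      with R \<open>0 < \<delta>\<close> obtain U where "U \<in> ?C \<delta>" "(\<Sum>i. diam_pow s (U i)) \<le> ennreal e"
        by blast
      then show "hausdorff_premeasure s \<delta> A \<le> 0 + ennreal e"
        unfolding hausdorff_premeasure_def by (auto intro: INF_lower2)
    qed
    then show "hausdorff_premeasure s \<delta> A = 0" by simp
  qed
  finally show ?thesis .
qed

lemma hausdorff_measure_null_mono:
  assumes null: "hausdorff_measure s B = 0" and AB: "A \<subseteq> B"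
  shows "hausdorff_measure s A = 0"
  unfolding hausdorff_measure_eq_0_iff
proof (intro allI impI)
  fix \<delta> e :: real assume "0 < \<delta>" "0 < e"
  with null obtain U where "B \<subseteq> (\<Union>i. U i)" "\<forall>i. bounded (U i) \<and> diameter (U i) \<le> \<delta>"
      "(\<Sum>i. diam_pow s (U i)) \<le> ennreal e"
    unfolding hausdorff_measure_eq_0_iff by blast
  with AB show "\<exists>U. A \<subseteq> (\<Union>i. U i) \<and> (\<forall>i. bounded (U i) \<and> diameter (U i) \<le> \<delta>) \<and>
      (\<Sum>i. diam_pow s (U i)) \<le> ennreal e"
    by (intro exI[of _ U]) simp
qed

text \<open>The \<open>n\<close>-th set gets a cover of total weight at most
  \<open>e / 2^(n+1)\<close>; the pairing function merges these covers into one sequence.\<close>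

lemma hausdorff_measure_null_UN:
  fixes A :: "nat \<Rightarrow> 'a::metric_space set"
  assumes null: "\<And>n. hausdorff_measure s (A n) = 0"
  shows "hausdorff_measure s (\<Union>n. A n) = 0"
  unfolding hausdorff_measure_eq_0_iff
proof (intro allI impI)
  fix \<delta> e :: real assume "0 < \<delta>" "0 < e"
  then have "\<exists>U. A n \<subseteq> (\<Union>i. U i) \<and> (\<forall>i. bounded (U i) \<and> diameter (U i) \<le> \<delta>) \<and>
      (\<Sum>i. diam_pow s (U i)) \<le> ennreal (e * (1/2) ^ Suc n)" for n
    using null[of n] unfolding hausdorff_measure_eq_0_iff by simp
  then obtain U where U: "\<And>n. A n \<subseteq> (\<Union>i. U n i)"
      "\<And>n i. bounded (U n i) \<and> diameter (U n i) \<le> \<delta>"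
      "\<And>n. (\<Sum>i. diam_pow s (U n i)) \<le> ennreal (e * (1/2) ^ Suc n)"
    by metis
  define V where "V k = case_prod U (prod_decode k)" for k
  have "(\<Union>n. A n) \<subseteq> (\<Union>k. V k)"
  proof
    fix x assume "x \<in> (\<Union>n. A n)"
    then obtain n i where "x \<in> U n i" using U(1) by blast
    then have "x \<in> V (prod_encode (n, i))" by (simp add: V_def)
    then show "x \<in> (\<Union>k. V k)" by blast
  qed
  moreover have "bounded (V k) \<and> diameter (V k) \<le> \<delta>" for k
    using U(2) by (simp add: V_def split_beta)
  moreover have "(\<Sum>k. diam_pow s (V k)) \<le> ennreal e"
  proof -
    have "(\<Sum>k. diam_pow s (V k)) = (\<Sum>n. \<Sum>i. diam_pow s (U n i))"
      using suminf_ennreal_2dimen[of "\<lambda>n. \<Sum>i. diam_pow s (U n i)" "\<lambda>p. diam_pow s (case_prod U p)"]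
      by (simp add: V_def)
    also have "\<dots> \<le> (\<Sum>n. ennreal (e * (1/2) ^ Suc n))"
      by (intro suminf_le U(3)) auto
    also have "\<dots> = ennreal e" using \<open>0 < e\<close> by (intro suminf_half_powers) simp
    finally show ?thesis .
  qed
  ultimately show "\<exists>V. (\<Union>n. A n) \<subseteq> (\<Union>i. V i) \<and> (\<forall>i. bounded (V i) \<and> diameter (V i) \<le> \<delta>) \<and>
      (\<Sum>i. diam_pow s (V i)) \<le> ennreal e"
    by blast
qed

lemma hausdorff_measure_empty: "hausdorff_measure s {} = 0"
  unfolding hausdorff_measure_eq_0_iff
  by (intro allI impI exI[of _ "\<lambda>_. {}"]) (simp add: diam_pow_def)

lemma hausdorff_measure_null_countable_UN:
  assumes "countable I" "\<And>i. i \<in> I \<Longrightarrow> hausdorff_measure s (A i) = 0"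
  shows "hausdorff_measure s (\<Union>i\<in>I. A i) = 0"
proof (cases "I = {}")
  case False
  with assms have "hausdorff_measure s (\<Union>n. A (from_nat_into I n)) = 0"
    by (intro hausdorff_measure_null_UN) (simp add: from_nat_into)
  moreover have "(\<Union>n. A (from_nat_into I n)) = (\<Union>i\<in>I. A i)"
    using range_from_nat_into[OF False \<open>countable I\<close>] by (metis image_image)
  ultimately show ?thesis by simp
qed (simp add: hausdorff_measure_empty)

lemma diam_pow_antimono:
  assumes "0 \<le> s" "s \<le> t" "bounded U" "diameter U \<le> 1"
  shows "diam_pow t U \<le> diam_pow s U"
proof -
  have d: "0 \<le> diameter U" using assms by (simp add: diameter_ge_0)
  have "diameter U powr t \<le> diameter U powr s"
    using d assms by (cases "diameter U = 0") (auto intro: powr_mono')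
  \<comment> \<open>This serves the case \<open>s = 0\<close>, where the gauge of a non-empty set is
    1 by convention although \<open>diameter U powr 0\<close> is 0 for a singleton.\<close>
  moreover have "diameter U powr t \<le> 1"
    using d assms by (metis order_trans powr_mono2 powr_one_eq_one)
  ultimately show ?thesis
    using assms by (auto simp: diam_pow_def intro: ennreal_leI)
qed

lemma hausdorff_measure_null_exponent_mono:
  assumes null: "hausdorff_measure s A = 0" and "0 \<le> s" "s \<le> t"
  shows "hausdorff_measure t A = 0"
  unfolding hausdorff_measure_eq_0_iff
proof (intro allI impI)
  fix \<delta> e :: real assume "0 < \<delta>" "0 < e"
  \<comment> \<open>Capping the mesh at 1 brings all diameters into the range where
    \<open>diam_pow\<close> decreases in the exponent.\<close>
  then have "0 < min \<delta> 1" by simp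
  with null \<open>0 < e\<close> obtain U where U: "A \<subseteq> (\<Union>i. U i)"
      "\<And>i. bounded (U i) \<and> diameter (U i) \<le> min \<delta> 1" "(\<Sum>i. diam_pow s (U i)) \<le> ennreal e"
    unfolding hausdorff_measure_eq_0_iff by meson
  have "(\<Sum>i. diam_pow t (U i)) \<le> (\<Sum>i. diam_pow s (U i))"
    using U(2) assms by (intro suminf_le diam_pow_antimono) auto
  then show "\<exists>U. A \<subseteq> (\<Union>i. U i) \<and> (\<forall>i. bounded (U i) \<and> diameter (U i) \<le> \<delta>) \<and>
      (\<Sum>i. diam_pow t (U i)) \<le> ennreal e"
    using U by (intro exI[of _ U]) auto
qed

section \<open>Open enlargements and G-delta hulls\<close>

text \<open>The \<open>h\<close>-neighbourhood of \<open>U\<close> is open, and its diameter exceeds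
  that of \<open>U\<close> by at most \<open>2 * h\<close>. Right continuity of
  \<open>x powr s\<close> at \<open>diameter U\<close> keeps the increase of the gauge below
  \<open>e\<close> for small \<open>h\<close>.\<close>

lemma diam_pow_open_enlargement:
  fixes U :: "'a::metric_space set"
  assumes "0 < s" "bounded U" "0 < e"
  shows "\<exists>V. open V \<and> U \<subseteq> V \<and> bounded V \<and> diameter V \<le> diameter U + e \<and>
           diam_pow s V \<le> diam_pow s U + ennreal e"
proof (cases "U = {}")
  case True
  then show ?thesis using \<open>0 < e\<close> by (intro exI[of _ "{}"]) (auto simp: diam_pow_def)
next
  case False
  have d: "0 \<le> diameter U" using assms by (simp add: diameter_ge_0)
  have "((\<lambda>h. (diameter U + 2 * h) powr s) \<longlongrightarrow> (diameter U + 2 * 0) powr s) (at_right 0)"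
  proof (intro tendsto_powr' tendsto_intros)
    \<comment> \<open>If \<open>U\<close> has diameter 0, the base of the power tends to 0, where
      continuity rests on \<open>0 < s\<close> and a non-negative base.\<close>
    show "diameter U + 2 * 0 \<noteq> 0 \<or> 0 < s \<and> (\<forall>\<^sub>F h in at_right 0. 0 \<le> diameter U + 2 * h)"
      using d \<open>0 < s\<close> by (auto simp: eventually_at_right_less eventually_at_right[of 0 1] intro!: exI[of _ 1])
  qed
  then have "\<forall>\<^sub>F h in at_right 0. (diameter U + 2 * h) powr s < diameter U powr s + e"
    using \<open>0 < e\<close> by (intro order_tendstoD) auto
  moreover have "\<forall>\<^sub>F h in at_right 0. 2 * h < e" "\<forall>\<^sub>F h in at_right (0::real). 0 < h"
    using \<open>0 < e\<close> by (auto simp: eventually_at_right[of 0 1] intro!: exI[of _ "e/2"])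
  ultimately have "\<forall>\<^sub>F h in at_right 0. (diameter U + 2 * h) powr s < diameter U powr s + e \<and>
      2 * h < e \<and> 0 < h"
    by eventually_elim auto
  then obtain h where h: "(diameter U + 2 * h) powr s < diameter U powr s + e" "2 * h < e" "0 < h"
    using eventually_happens'[OF trivial_limit_at_right_real] by blast
  define V where "V = (\<Union>x\<in>U. ball x h)"
  have UV: "U \<subseteq> V" using h by (auto simp: V_def)
  have dist: "dist x y \<le> diameter U + 2 * h" if xy: "x \<in> V" "y \<in> V" for x y
  proof -
    obtain u v where uv: "u \<in> U" "v \<in> U" "dist u x < h" "dist v y < h"
      using xy by (auto simp: V_def)
    have "dist x y \<le> dist u x + dist u v + dist v y"
      using dist_triangle[of x y u] dist_triangle[of u y v] by (simp add: dist_commute)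
    with uv diameter_bounded_bound[OF \<open>bounded U\<close> uv(1,2)] show ?thesis by simp
  qed
  then have bV: "bounded V"
    unfolding bounded_two_points by blast
  have dV: "diameter V \<le> diameter U + 2 * h"
    using dist d h unfolding diameter_def[of V] by (auto intro!: cSUP_least)
  have "diameter V powr s \<le> (diameter U + 2 * h) powr s"
    using dV diameter_ge_0[OF bV] \<open>0 < s\<close> by (simp add: powr_mono2)
  then have "diam_pow s V \<le> ennreal (diameter U powr s + e)"
    using h \<open>0 < s\<close> by (auto simp: diam_pow_def simp del: ennreal_plus intro!: ennreal_leI)
  also have "\<dots> = diam_pow s U + ennreal e"
    using False assms by (simp add: diam_pow_def)
  finally show ?thesis
    using UV bV dV h by (intro exI[of _ V]) (auto simp: V_def)
qed

text \<open>For each \<open>k\<close>, a cover of mesh and weight at most \<open>r k\<close> is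
  enlarged to an open one with union \<open>W k\<close>. Each of these covers also covers the
  intersection, which is therefore null. The gain is that the complement of the hull is a countable
  union of closed sets, as the sum theorem requires.\<close>

lemma hausdorff_measure_null_gdelta_hull:
  fixes A :: "'a::metric_space set"
  assumes "0 < s" and null: "hausdorff_measure s A = 0"
  shows "\<exists>W :: nat \<Rightarrow> 'a set. (\<forall>n. open (W n)) \<and> A \<subseteq> (\<Inter>n. W n) \<and>
           hausdorff_measure s (\<Inter>n. W n) = 0"
proof -
  define r :: "nat \<Rightarrow> real" where "r k = inverse (Suc k)" for k
  have r: "0 < r k" for k by (simp add: r_def)
  have "\<exists>U. A \<subseteq> (\<Union>i. U i) \<and> (\<forall>i. bounded (U i) \<and> diameter (U i) \<le> r k) \<and>
      (\<Sum>i. diam_pow s (U i)) \<le> ennreal (r k)" for k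
    using null r[of k] unfolding hausdorff_measure_eq_0_iff by blast
  then obtain U where U: "\<And>k. A \<subseteq> (\<Union>i. U k i)"
      "\<And>k i. bounded (U k i)" "\<And>k i. diameter (U k i) \<le> r k"
      "\<And>k. (\<Sum>i. diam_pow s (U k i)) \<le> ennreal (r k)"
    by metis
  \<comment> \<open>The geometric tolerances add at most \<open>r k\<close> to the total weight and
    to each diameter; hence the bounds \<open>2 * r k\<close> below.\<close>
  have "\<exists>V. open V \<and> U k i \<subseteq> V \<and> bounded V \<and> diameter V \<le> diameter (U k i) + r k * (1/2) ^ Suc i \<and>
      diam_pow s V \<le> diam_pow s (U k i) + ennreal (r k * (1/2) ^ Suc i)" for k i
    using r[of k] by (intro diam_pow_open_enlargement \<open>0 < s\<close> U) simp
  then obtain V where V: "\<And>k i. open (V k i)" "\<And>k i. U k i \<subseteq> V k i" "\<And>k i. bounded (V k i)"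
      "\<And>k i. diameter (V k i) \<le> diameter (U k i) + r k * (1/2) ^ Suc i"
      "\<And>k i. diam_pow s (V k i) \<le> diam_pow s (U k i) + ennreal (r k * (1/2) ^ Suc i)"
    by metis
  have dV: "diameter (V k i) \<le> 2 * r k" for k i
  proof -
    have "r k * (1/2) ^ Suc i \<le> r k * 1"
      using r[of k] by (intro mult_left_mono power_le_one) auto
    then show ?thesis using V(4)[of k i] U(3)[of k i] by simp
  qed
  have sV: "(\<Sum>i. diam_pow s (V k i)) \<le> ennreal (2 * r k)" for k
  proof -
    have "(\<Sum>i. diam_pow s (V k i)) \<le> (\<Sum>i. diam_pow s (U k i) + ennreal (r k * (1/2) ^ Suc i))"
      by (intro suminf_le V) auto
    also have "\<dots> = (\<Sum>i. diam_pow s (U k i)) + (\<Sum>i. ennreal (r k * (1/2) ^ Suc i))"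
      by (intro suminf_add[symmetric]) auto
    also have "\<dots> \<le> ennreal (r k) + ennreal (r k)"
      using U(4)[of k] r[of k] by (subst suminf_half_powers) (auto intro: add_right_mono)
    also have "\<dots> = ennreal (2 * r k)"
      using r[of k] by (simp flip: ennreal_plus)
    finally show ?thesis .
  qed
  define W where "W k = (\<Union>i. V k i)" for k
  have "hausdorff_measure s (\<Inter>k. W k) = 0"
    unfolding hausdorff_measure_eq_0_iff
  proof (intro allI impI)
    fix \<delta> e :: real assume "0 < \<delta>" "0 < e"
    then obtain k where k: "r k < min (\<delta> / 2) (e / 2)"
      using reals_Archimedean[of "min (\<delta> / 2) (e / 2)"] by (auto simp: r_def)
    have "(\<Inter>k. W k) \<subseteq> (\<Union>i. V k i)" by (auto simp: W_def)
    moreover have "diameter (V k i) \<le> \<delta>" for i using dV[of k i] k by simp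
    moreover have "(\<Sum>i. diam_pow s (V k i)) \<le> ennreal e"
      using k by (intro order_trans[OF sV[of k]] ennreal_leI) simp
    ultimately show "\<exists>U. (\<Inter>k. W k) \<subseteq> (\<Union>i. U i) \<and> (\<forall>i. bounded (U i) \<and> diameter (U i) \<le> \<delta>) \<and>
        (\<Sum>i. diam_pow s (U i)) \<le> ennreal e"
      using V(3) by blast
  qed
  moreover have "open (W k)" for k using V(1) by (auto simp: W_def)
  moreover have "A \<subseteq> (\<Inter>k. W k)"
    unfolding W_def using U(1) V(2) by (meson INF_greatest SUP_mono' order_trans)
  ultimately show ?thesis by blast
qed

section \<open>Hausdorff dimension and null measure\<close>

text \<open>A strict bound yields an admissible exponent below \<open>s\<close>, and nullity passes
  to larger exponents. At the critical exponent itself the measure may be positive.\<close>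

lemma hausdorff_measure_eq_0_if_dim_less:
  assumes "hausdorff_dim A < ereal s"
  shows "hausdorff_measure s A = 0"
proof (cases "A = {}")
  case False
  with assms obtain t where "0 \<le> t" "hausdorff_measure t A = 0" "t < s"
    by (auto simp: hausdorff_dim_def INF_less_iff)
  then show ?thesis using hausdorff_measure_null_exponent_mono less_imp_le by blast
qed (simp add: hausdorff_measure_empty)

lemma hausdorff_dim_nonneg: "A \<noteq> {} \<Longrightarrow> 0 \<le> hausdorff_dim A"
  unfolding hausdorff_dim_def by (simp add: le_INF_iff)

lemma hausdorff_dim_ge: "- 1 \<le> hausdorff_dim A"
proof (cases "A = {}")
  case False
  have "- 1 \<le> (0::ereal)" by simp
  then show ?thesis using hausdorff_dim_nonneg[OF False] by (rule order_trans)
qed (simp add: hausdorff_dim_def)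

lemma hausdorff_dim_le:
  assumes "0 \<le> s" "hausdorff_measure s A = 0"
  shows "hausdorff_dim A \<le> ereal s"
proof (cases "A = {}")
  case True
  have "- 1 \<le> (0::ereal)" by simp
  also have "0 \<le> ereal s" using assms by simp
  finally show ?thesis using True by (simp add: hausdorff_dim_def)
next
  case False
  then show ?thesis using assms by (auto simp: hausdorff_dim_def intro: INF_lower2)
qed

section \<open>The countable sum theorem for closed sets\<close>

text \<open>One step of the sum theorem. Each of two parts of \<open>F\<close> is attached to
  \<open>C\<close> or to \<open>D\<close>, and normality separates the two resulting closed
  sets.\<close>

lemma separation_covering_closed:
  assumes norm: "normal_space T" and lind: "Lindelof_space T" and F: "closedin T F"
    and basis: "\<And>x W. openin T W \<Longrightarrow> x \<in> W \<Longrightarrow> x \<in> F \<Longrightarrow>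
                  \<exists>U. openin T U \<and> x \<in> U \<and> U \<subseteq> W \<and> T frontier_of U \<inter> F = {}"
    and C: "closedin T C" and D: "closedin T D" and CD: "disjnt C D"
  shows "\<exists>U V. openin T U \<and> openin T V \<and> C \<subseteq> U \<and> D \<subseteq> V \<and> F \<subseteq> U \<union> V \<and>
           disjnt (T closure_of U) (T closure_of V)"
proof -
  \<comment> \<open>\<open>F\<close> is split into two relatively clopen parts by disjointifying a countable cover.\<close>
  define \<W> where "\<W> = {W. openin T W \<and> T frontier_of W \<inter> F = {} \<and> (W \<inter> C = {} \<or> W \<inter> D = {})}"
  have FT: "F \<subseteq> topspace T" using F by (rule closedin_subset)
  have "F \<subseteq> \<Union>\<W>"
  proof
    fix x assume x: "x \<in> F"
    obtain E where E: "closedin T E" "x \<notin> E" "E = C \<or> E = D"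
      using C D CD by (metis disjnt_iff)
    then have "openin T (topspace T - E)" "x \<in> topspace T - E" using x FT by auto
    with basis x obtain U where "openin T U" "x \<in> U" "U \<subseteq> topspace T - E" "T frontier_of U \<inter> F = {}"
      by meson
    with E show "x \<in> \<Union>\<W>" by (auto simp: \<W>_def)
  qed
  moreover have "\<forall>W\<in>\<W>. openin T W" by (simp add: \<W>_def)
  ultimately obtain \<V> where \<V>: "countable \<V>" "\<V> \<subseteq> \<W>" "F \<subseteq> \<Union>\<V>"
    using Lindelof_space_closedin_subtopology[OF lind F]
    unfolding Lindelof_space_subtopology_subset[OF FT] by meson
  \<comment> \<open>Inserting the empty set makes the family non-empty, so that
    \<open>from_nat_into\<close> enumerates it even if \<open>\<V>\<close> is empty.\<close>
  define w where "w = from_nat_into (insert {} \<V>)"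
  have rw: "range w = insert {} \<V>"
    unfolding w_def using \<V>(1) by (intro range_from_nat_into) auto
  have "{} \<in> \<W>" by (simp add: \<W>_def)
  then have wW: "w i \<in> \<W>" for i using rw \<V>(2) rangeI[of w i] by auto
  then have wo: "openin T (w i)" and wf: "T frontier_of (w i) \<inter> F = {}"
    and wCD: "w i \<inter> C = {} \<or> w i \<inter> D = {}" for i
    by (auto simp: \<W>_def)
  \<comment> \<open>Within \<open>F\<close>, each \<open>w i\<close> agrees with its closure.
    Subtracting the earlier closures, which keeps \<open>E i\<close> open, therefore removes from
    \<open>F\<close> only points of earlier \<open>w j\<close>.\<close>
  have wF: "x \<in> w i" if "x \<in> F" "x \<in> T closure_of (w i)" for x i
    using wf[of i] wo[of i] that by (auto simp: frontier_of_def interior_of_openin)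
  define E where "E i = w i - (\<Union>j<i. T closure_of (w j))" for i
  have Eo: "openin T (E i)" for i
    unfolding E_def using wo by (intro openin_diff closedin_Union) auto
  have FE: "\<exists>i. x \<in> E i" if "x \<in> F" for x
  proof -
    have "\<exists>i. x \<in> w i" using that \<V>(3) rw by blast
    then obtain i where "x \<in> w i" "\<And>j. j < i \<Longrightarrow> x \<notin> w j"
      using exists_least_iff[of "\<lambda>i. x \<in> w i"] by blast
    with wF that show ?thesis by (auto simp: E_def)
  qed
  have Edisj: "i = j" if "x \<in> E i" "x \<in> E j" for x i j
  proof -
    have "w k \<subseteq> T closure_of (w k)" for k
      using wo by (intro closure_of_subset openin_subset)
    then show ?thesis using that unfolding E_def by (metis DiffD1 DiffD2 UN_I lessThan_iff linorder_neqE_nat subsetD)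
  qed
  \<comment> \<open>The pieces of \<open>P\<close> lie in sets missing \<open>D\<close>; those of
    \<open>Q\<close> lie in sets that meet \<open>D\<close> and hence miss \<open>C\<close>.\<close>
  define P where "P = (\<Union>i\<in>{i. w i \<inter> D = {}}. E i)"
  define Q where "Q = (\<Union>i\<in>{i. w i \<inter> D \<noteq> {}}. E i)"
  have Po: "openin T P" and Qo: "openin T Q" unfolding P_def Q_def using Eo by auto
  have "x \<in> P \<union> Q" if "x \<in> F" for x
    using FE[OF that] by (auto simp: P_def Q_def)
  moreover have "x \<notin> Q" if "x \<in> P" for x
    using that by (auto simp: P_def Q_def dest: Edisj)
  ultimately have PQ: "F \<subseteq> P \<union> Q" "P \<inter> Q = {}" by auto
  have Ew: "E i \<subseteq> w i" for i by (auto simp: E_def)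
  have PD: "P \<inter> D = {}" and QC: "Q \<inter> C = {}"
    using Ew wCD by (fastforce simp: P_def Q_def)+
  \<comment> \<open>Subtracting an open part leaves a closed set, and \<open>F - Q\<close> lies in
    \<open>P\<close> while \<open>F - P\<close> lies in \<open>Q\<close>. Disjointness follows
    because \<open>P\<close> misses \<open>D\<close> and \<open>Q\<close> misses
    \<open>C\<close>.\<close>
  have "closedin T (C \<union> (F - Q))" "closedin T (D \<union> (F - P))"
    using C D F Po Qo by (auto intro: closedin_diff)
  moreover have "disjnt (C \<union> (F - Q)) (D \<union> (F - P))"
    using CD PQ PD QC unfolding disjnt_iff by blast
  ultimately obtain U V where "openin T U" "openin T V" "C \<union> (F - Q) \<subseteq> U" "D \<union> (F - P) \<subseteq> V"
      "disjnt (T closure_of U) (T closure_of V)"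
    using norm unfolding normal_space_disjoint_closures by meson
  moreover from this have "F \<subseteq> U \<union> V" using PQ by blast
  ultimately show ?thesis by blast
qed

text \<open>The countable sum theorem for dimension zero, phrased inside the ambient space: disjoint
  neighbourhoods of \<open>C\<close> and of the complement of \<open>W\<close> are enlarged successively so that the \<open>n\<close>-th
  step absorbs \<open>F n\<close>.\<close>

lemma frontier_avoiding_countable_closed_union:
  fixes F :: "nat \<Rightarrow> 'a set"
  assumes norm: "normal_space T" and lind: "Lindelof_space T" and F: "\<And>n. closedin T (F n)"
    and basis: "\<And>n x W. openin T W \<Longrightarrow> x \<in> W \<Longrightarrow> x \<in> F n \<Longrightarrow>
                  \<exists>U. openin T U \<and> x \<in> U \<and> U \<subseteq> W \<and> T frontier_of U \<inter> F n = {}"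
    and C: "closedin T C" and W: "openin T W" and CW: "C \<subseteq> W"
  shows "\<exists>U. openin T U \<and> C \<subseteq> U \<and> U \<subseteq> W \<and> T frontier_of U \<inter> (\<Union>n. F n) = {}"
proof -
  define P where "P = (\<lambda>(n::nat) (U, V). openin T U \<and> openin T V \<and>
     disjnt (T closure_of U) (T closure_of V) \<and> C \<subseteq> U \<and> topspace T - W \<subseteq> V \<and> F n \<subseteq> U \<union> V)"
  define R where "R = (\<lambda>(n::nat) (U::'a set, V::'a set) (U', V'). U \<subseteq> U' \<and> V \<subseteq> V')"
  have "\<exists>f. \<forall>n. P n (f n) \<and> R n (f n) (f (Suc n))"
  proof (rule dependent_nat_choice)
    have "disjnt C (topspace T - W)" using CW by (auto simp: disjnt_iff)
    then obtain U V where "P 0 (U, V)"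
      using separation_covering_closed[OF norm lind F[of 0] basis C, of "topspace T - W"] W
      unfolding P_def by fastforce
    then show "\<exists>p. P 0 p" by blast
  next
    fix p n assume "P n p"
    then obtain U V where p: "p = (U, V)" and UV: "openin T U" "openin T V"
        "disjnt (T closure_of U) (T closure_of V)" "C \<subseteq> U" "topspace T - W \<subseteq> V"
      by (auto simp: P_def)
    \<comment> \<open>The separation is applied to the closures of \<open>U\<close> and
      \<open>V\<close>; this is why the invariant \<open>P\<close> demands disjoint closures and not
      just disjoint sets.\<close>
    obtain U' V' where UV': "openin T U'" "openin T V'" "T closure_of U \<subseteq> U'" "T closure_of V \<subseteq> V'"
        "F (Suc n) \<subseteq> U' \<union> V'" "disjnt (T closure_of U') (T closure_of V')"
      using separation_covering_closed[OF norm lind F[of "Suc n"] basis _ _ UV(3)] by auto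
    have "U \<subseteq> U'" "V \<subseteq> V'"
      using UV UV' closure_of_subset openin_subset by (metis order_trans)+
    then have "P (Suc n) (U', V') \<and> R n p (U', V')"
      using UV UV' p by (auto simp: P_def R_def)
    then show "\<exists>q. P (Suc n) q \<and> R n p q" by blast
  qed
  then obtain f where f: "\<And>n. P n (f n)" "\<And>n. R n (f n) (f (Suc n))" by blast
  define U where "U n = fst (f n)" for n
  define V where "V n = snd (f n)" for n
  have UV: "openin T (U n)" "openin T (V n)" "disjnt (T closure_of (U n)) (T closure_of (V n))"
      "C \<subseteq> U n" "topspace T - W \<subseteq> V n" "F n \<subseteq> U n \<union> V n" for n
    using f(1)[of n] by (auto simp: P_def U_def V_def split_beta)
  have "U n \<subseteq> U (Suc n)" "V n \<subseteq> V (Suc n)" for n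
    using f(2)[of n] by (auto simp: R_def U_def V_def split_beta)
  then have mono: "U m \<subseteq> U n" "V m \<subseteq> V n" if "m \<le> n" for m n
    using that lift_Suc_mono_le[of U] lift_Suc_mono_le[of V] by blast+
  have "U m \<inter> V n = {}" for m n
  proof -
    have "U m \<subseteq> U (max m n)" "V n \<subseteq> V (max m n)" by (simp_all add: mono)
    moreover have "U (max m n) \<inter> V (max m n) = {}"
      using UV(1-3)[of "max m n"] closure_of_subset openin_subset
      unfolding disjnt_def by (metis Int_mono subset_empty)
    ultimately show ?thesis by blast
  qed
  then have disj: "(\<Union>n. U n) \<inter> (\<Union>n. V n) = {}" by blast
  have Uo: "openin T (\<Union>n. U n)" and Vo: "openin T (\<Union>n. V n)" using UV by auto
  \<comment> \<open>The closure of the union may exceed the union of the closures, but it still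
    misses the open set formed by the \<open>V n\<close>. The frontier thus misses both unions,
    which together contain every \<open>F n\<close>.\<close>
  have "T closure_of (\<Union>n. U n) \<inter> (\<Union>n. V n) = {}"
    using disj openin_Int_closure_of_eq_empty[OF Vo] by (metis inf_commute)
  then have "T frontier_of (\<Union>n. U n) \<inter> (\<Union>n. F n) = {}"
    using UV(6) Uo by (fastforce simp: frontier_of_def interior_of_openin)
  moreover have "(\<Union>n. U n) \<subseteq> W"
    using disj UV(5)[of 0] openin_subset[OF Uo] by blast
  moreover have "C \<subseteq> (\<Union>n. U n)" using UV(4)[of 0] by blast
  ultimately show ?thesis using Uo by (intro exI[of _ "\<Union>n. U n"] conjI)
qed

section \<open>Bases and countability\<close>

lemma topology_basis_iff:
  "topology_basis T \<B> \<longleftrightarrow> (\<forall>U\<in>\<B>. openin T U) \<and>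
     (\<forall>V. openin T V \<longrightarrow> (\<forall>x\<in>V. \<exists>U\<in>\<B>. x \<in> U \<and> U \<subseteq> V))"
proof -
  have *: "(\<exists>\<V>\<subseteq>\<B>. \<Union>\<V> = V) \<longleftrightarrow> (\<forall>x\<in>V. \<exists>U\<in>\<B>. x \<in> U \<and> U \<subseteq> V)" for V
  proof
    assume "\<exists>\<V>\<subseteq>\<B>. \<Union>\<V> = V"
    then show "\<forall>x\<in>V. \<exists>U\<in>\<B>. x \<in> U \<and> U \<subseteq> V" by auto
  next
    assume "\<forall>x\<in>V. \<exists>U\<in>\<B>. x \<in> U \<and> U \<subseteq> V"
    then show "\<exists>\<V>\<subseteq>\<B>. \<Union>\<V> = V" by (intro exI[of _ "{U \<in> \<B>. U \<subseteq> V}"]) auto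
  qed
  show ?thesis by (simp add: topology_basis_def *)
qed

text \<open>One member of \<open>\<B>\<close> is chosen between each pair of sets of a countable
  base that admits one. Countability matters because only countable unions of null frontiers are
  known to be null.\<close>

lemma countable_subbasis_of_basis:
  assumes "second_countable T" and \<B>: "topology_basis T \<B>"
  shows "\<exists>\<B>'\<subseteq>\<B>. countable \<B>' \<and> topology_basis T \<B>'"
proof -
  obtain \<C> where \<C>: "countable \<C>" "\<forall>V\<in>\<C>. openin T V"
      "\<forall>U x. openin T U \<and> x \<in> U \<longrightarrow> (\<exists>V\<in>\<C>. x \<in> V \<and> V \<subseteq> U)"
    using \<open>second_countable T\<close> unfolding second_countable_def by blast
  define I where "I = {(V, W) \<in> \<C> \<times> \<C>. \<exists>B\<in>\<B>. V \<subseteq> B \<and> B \<subseteq> W}"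
  have "\<forall>p\<in>I. \<exists>B\<in>\<B>. fst p \<subseteq> B \<and> B \<subseteq> snd p" by (auto simp: I_def)
  then obtain b where b: "\<And>p. p \<in> I \<Longrightarrow> b p \<in> \<B> \<and> fst p \<subseteq> b p \<and> b p \<subseteq> snd p" by metis
  have "topology_basis T (b ` I)"
    unfolding topology_basis_iff
  proof (intro conjI ballI allI impI)
    fix U assume "U \<in> b ` I" then show "openin T U" using b \<B> by (auto simp: topology_basis_iff)
  next
    fix U x assume "openin T U" "x \<in> U"
    then obtain W where W: "W \<in> \<C>" "x \<in> W" "W \<subseteq> U" using \<C>(3) by blast
    then obtain B where B: "B \<in> \<B>" "x \<in> B" "B \<subseteq> W" using \<B> \<C>(2) by (meson topology_basis_iff)
    then obtain V where V: "V \<in> \<C>" "x \<in> V" "V \<subseteq> B" using \<B> \<C>(3) by (meson topology_basis_iff)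
    have "(V, W) \<in> I" using W B V by (auto simp: I_def)
    with b[of "(V, W)"] V W show "\<exists>B\<in>b ` I. x \<in> B \<and> B \<subseteq> U"
      by (intro bexI[of _ "b (V, W)"]) auto
  qed
  moreover have "countable I"
    using \<C>(1) by (rule_tac countable_subset[of _ "\<C> \<times> \<C>"]) (auto simp: I_def)
  ultimately show ?thesis using b by blast
qed

lemma separable_metric_imp_second_countable:
  fixes X :: "'a::metric_space set"
  assumes "separable_space (top_of_set X)"
  shows "second_countable (top_of_set X)"
proof -
  obtain C where C: "countable C" "C \<subseteq> X" "top_of_set X closure_of C = X"
    using assms by (auto simp: separable_space_def)
  define \<B> where "\<B> = (\<lambda>(c, n). X \<inter> ball c (inverse (Suc n))) ` (C \<times> (UNIV :: nat set))"
  show ?thesis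
    unfolding second_countable_def
  proof (intro exI[of _ \<B>] conjI ballI allI impI)
    show "countable \<B>" using C by (auto simp: \<B>_def)
    show "openin (top_of_set X) V" if "V \<in> \<B>" for V using that by (auto simp: \<B>_def)
    fix U x assume U: "openin (top_of_set X) U \<and> x \<in> U"
    then obtain e where e: "0 < e" "X \<inter> ball x e \<subseteq> U" and x: "x \<in> X"
      by (metis openin_contains_ball inf_commute openin_subset subsetD topspace_euclidean_subtopology)
    obtain n where n: "inverse (real (Suc n)) < e / 2" using reals_Archimedean[of "e/2"] e by auto
    have "x \<in> top_of_set X closure_of C" using C(3) x by simp
    then have "\<forall>S. x \<in> S \<and> openin (top_of_set X) S \<longrightarrow> (\<exists>c. c \<in> C \<and> c \<in> S)"
      unfolding in_closure_of by (rule conjunct2)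
    from this[rule_format, of "X \<inter> ball x (inverse (Suc n))"] x
    obtain c where c: "c \<in> C" "dist x c < inverse (Suc n)" by auto
    have "X \<inter> ball c (inverse (Suc n)) \<subseteq> X \<inter> ball x e"
    proof
      fix y assume "y \<in> X \<inter> ball c (inverse (Suc n))"
      with dist_triangle[of x y c] c n show "y \<in> X \<inter> ball x e" by auto
    qed
    then show "\<exists>V\<in>\<B>. x \<in> V \<and> V \<subseteq> U"
      using c x e by (intro bexI[of _ "X \<inter> ball c (inverse (Suc n))"]) (auto simp: \<B>_def dist_commute)
  qed
qed

lemma topology_basis_superset:
  assumes \<B>: "topology_basis T \<B>" and "\<B> \<subseteq> \<C>" "\<And>U. U \<in> \<C> \<Longrightarrow> openin T U"
  shows "topology_basis T \<C>"
  unfolding topology_basis_iff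
proof (intro conjI ballI allI impI)
  fix V x assume "openin T V" "x \<in> V"
  with \<B> have "\<exists>U\<in>\<B>. x \<in> U \<and> U \<subseteq> V" unfolding topology_basis_iff by simp
  with \<open>\<B> \<subseteq> \<C>\<close> show "\<exists>U\<in>\<C>. x \<in> U \<and> U \<subseteq> V" by blast
qed (fact assms(3))

section \<open>Bases with frontiers in a G-delta set\<close>

text \<open>The frontiers of a countable subbasis have a null union, and its G-delta hull contains
  them all. Passing to all open sets with frontier in the hull makes the basis depend on
  \<open>W\<close> alone.\<close>

lemma gdelta_containing_basis_frontiers:
  fixes X :: "'a::metric_space set"
  assumes X: "second_countable (top_of_set X)" and \<B>: "topology_basis (top_of_set X) \<B>"
    and dim: "\<And>U. U \<in> \<B> \<Longrightarrow> hausdorff_dim (top_of_set X frontier_of U) < ereal s" and "0 < s"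
  shows "\<exists>W :: nat \<Rightarrow> 'a set. (\<forall>k. open (W k)) \<and> hausdorff_measure s (\<Inter>k. W k) = 0 \<and>
           topology_basis (top_of_set X)
             {U. openin (top_of_set X) U \<and> top_of_set X frontier_of U \<subseteq> (\<Inter>k. W k)}"
proof -
  obtain \<B>' where \<B>': "\<B>' \<subseteq> \<B>" "countable \<B>'" "topology_basis (top_of_set X) \<B>'"
    using countable_subbasis_of_basis[OF X \<B>] by blast
  have "hausdorff_measure s (\<Union>U\<in>\<B>'. top_of_set X frontier_of U) = 0"
    using \<B>'(1,2) dim
    by (intro hausdorff_measure_null_countable_UN hausdorff_measure_eq_0_if_dim_less) auto
  then obtain W :: "nat \<Rightarrow> 'a set" where W: "\<forall>k. open (W k)"
      "(\<Union>U\<in>\<B>'. top_of_set X frontier_of U) \<subseteq> (\<Inter>k. W k)"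
      "hausdorff_measure s (\<Inter>k. W k) = 0"
    using hausdorff_measure_null_gdelta_hull[OF \<open>0 < s\<close>] by blast
  have "\<B>' \<subseteq> {U. openin (top_of_set X) U \<and> top_of_set X frontier_of U \<subseteq> (\<Inter>k. W k)}"
    using W(2) \<B>'(3) by (auto simp: topology_basis_iff)
  then have "topology_basis (top_of_set X)
      {U. openin (top_of_set X) U \<and> top_of_set X frontier_of U \<subseteq> (\<Inter>k. W k)}"
    by (rule topology_basis_superset[OF \<B>'(3)]) simp
  with W show ?thesis by (intro exI[of _ W]) simp
qed

text \<open>The sets \<open>X - W n k\<close>, listed as one sequence \<open>F\<close>, are closed
  in \<open>X\<close>, and the \<open>n\<close>-th basis has frontiers avoiding them. By the sum
  theorem a single basis avoids them all simultaneously.\<close>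

lemma topology_basis_frontier_subset_INT:
  fixes X :: "'a::metric_space set" and W :: "nat \<Rightarrow> nat \<Rightarrow> 'a set"
  assumes X: "second_countable (top_of_set X)" and W: "\<And>n k. open (W n k)"
    and basis: "\<And>n. topology_basis (top_of_set X)
             {U. openin (top_of_set X) U \<and> top_of_set X frontier_of U \<subseteq> (\<Inter>k. W n k)}"
  shows "topology_basis (top_of_set X)
             {U. openin (top_of_set X) U \<and> top_of_set X frontier_of U \<subseteq> (\<Inter>n. \<Inter>k. W n k)}"
proof -
  let ?T = "top_of_set X"
  define F where "F m = X - case_prod W (prod_decode m)" for m
  have norm: "normal_space ?T"
    by (intro metrizable_imp_normal_space metrizable_space_subtopology metrizable_space_euclidean)
  have lind: "Lindelof_space ?T" using X by (rule second_countable_imp_Lindelof_space)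
  have F: "closedin ?T (F m)" for m
  proof -
    have "openin ?T (X \<inter> case_prod W (prod_decode m))" using W by (auto simp: split_beta)
    then have "closedin ?T (topspace ?T - X \<inter> case_prod W (prod_decode m))" by blast
    then show ?thesis by (simp add: F_def Diff_Int_distrib2 Diff_Int)
  qed
  have Fb: "\<exists>U. openin ?T U \<and> x \<in> U \<and> U \<subseteq> V \<and> ?T frontier_of U \<inter> F m = {}"
    if "openin ?T V" "x \<in> V" for m x V
  proof -
    obtain n k where nk: "prod_decode m = (n, k)" by fastforce
    from basis[of n, unfolded topology_basis_iff, THEN conjunct2, rule_format, OF that]
    obtain U where "openin ?T U" "?T frontier_of U \<subseteq> (\<Inter>k. W n k)" "x \<in> U" "U \<subseteq> V"
      by auto
    then show ?thesis by (intro exI[of _ U]) (auto simp: F_def nk)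
  qed
  have UF: "(\<Union>m. F m) = X - (\<Inter>n. \<Inter>k. W n k)"
  proof
    show "X - (\<Inter>n. \<Inter>k. W n k) \<subseteq> (\<Union>m. F m)"
    proof
      fix x assume "x \<in> X - (\<Inter>n. \<Inter>k. W n k)"
      then obtain n k where "x \<in> X" "x \<notin> W n k" by blast
      then have "x \<in> F (prod_encode (n, k))" by (simp add: F_def)
      then show "x \<in> (\<Union>m. F m)" by blast
    qed
  qed (auto simp: F_def split_beta)
  have "\<exists>U. (openin ?T U \<and> ?T frontier_of U \<subseteq> (\<Inter>n. \<Inter>k. W n k)) \<and> x \<in> U \<and> U \<subseteq> V"
    if V: "openin ?T V" "x \<in> V" for V x
  proof -
    have "x \<in> X" using V openin_subset by force
    \<comment> \<open>With a singleton as the inner closed set, the separation statement becomes the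
      basis condition at \<open>x\<close>.\<close>
    then have "closedin ?T {x}" by auto
    then obtain U where U: "openin ?T U" "{x} \<subseteq> U" "U \<subseteq> V" "?T frontier_of U \<inter> (\<Union>m. F m) = {}"
      using frontier_avoiding_countable_closed_union[where F = F, OF norm lind F Fb _ V(1), where C = "{x}"] V(2) by auto
    moreover have "?T frontier_of U \<subseteq> X"
      using frontier_of_subset_topspace[of ?T U] by simp
    ultimately have "?T frontier_of U \<subseteq> (\<Inter>n. \<Inter>k. W n k)" unfolding UF by blast
    with U show ?thesis by (intro exI[of _ U]) simp
  qed
  then show ?thesis unfolding topology_basis_iff by auto
qed

section \<open>Attainment of the infimum\<close>

text \<open>A basis of a non-empty space has a member, and its frontier has dimension at least -1,
  so \<open>d - 1\<close> is at least -1.\<close>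

lemma tH_bounds_nonneg:
  assumes "X \<noteq> {}" "d \<in> tH_bounds X"
  shows "0 \<le> d"
proof -
  obtain \<U> where \<U>: "topology_basis (top_of_set X) \<U>"
      "\<And>U. U \<in> \<U> \<Longrightarrow> hausdorff_dim (top_of_set X frontier_of U) \<le> d - 1"
    using assms(2) by (auto simp: tH_bounds_def)
  obtain x where "x \<in> X" using assms(1) by blast
  moreover have "openin (top_of_set X) X" by simp
  ultimately obtain U where "U \<in> \<U>" using \<U>(1) unfolding topology_basis_iff by blast
  then have "- 1 \<le> d - 1" using \<U>(2) hausdorff_dim_ge order_trans by blast
  then show ?thesis by (cases d) (auto simp: one_ereal_def)
qed

lemma infinity_in_tH_bounds: "\<infinity> \<in> tH_bounds X"
  unfolding tH_bounds_def
  by (auto simp: topology_basis_iff intro!: exI[of _ "Collect (openin (top_of_set X))"])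

theorem corollary3p8:
  fixes X :: "'a::metric_space set"
  assumes "X \<noteq> {}" and "separable_space (top_of_set X)"
  shows "topological_hausdorff_dim X \<in> tH_bounds X \<and>
         (\<forall>d \<in> tH_bounds X. topological_hausdorff_dim X \<le> d)"
proof -
  let ?T = "top_of_set X"
  define d where "d = Inf (tH_bounds X)"
  have X: "second_countable ?T" using assms(2) by (rule separable_metric_imp_second_countable)
  have "0 \<le> d" unfolding d_def using tH_bounds_nonneg[OF assms(1)] by (intro Inf_greatest)
  \<comment> \<open>At 1 the bound \<open>d - 1\<close> changes sign; from there on, exponents above
    it are positive, as the hull construction requires.\<close>
  then consider "d = \<infinity>" | r where "d = ereal r" "0 \<le> r" "r < 1" | r where "d = ereal r" "1 \<le> r"
    by (cases d) (auto simp: not_less[symmetric])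
  then have "d \<in> tH_bounds X"
  proof cases
    case 1
    then show ?thesis by (simp add: infinity_in_tH_bounds)
  next
    case 2
    then have "Inf (tH_bounds X) < 1" by (simp add: d_def one_ereal_def)
    then obtain d' where d': "d' \<in> tH_bounds X" "d' < 1" unfolding Inf_less_iff by blast
    then obtain \<U> where \<U>: "topology_basis ?T \<U>"
        "\<And>U. U \<in> \<U> \<Longrightarrow> hausdorff_dim (?T frontier_of U) \<le> d' - 1"
      by (auto simp: tH_bounds_def)
    have "d' - 1 < 0" using d'(2) by (cases d') (auto simp: one_ereal_def zero_ereal_def)
    then have "?T frontier_of U = {}" if "U \<in> \<U>" for U
      using \<U>(2)[OF that] hausdorff_dim_nonneg[of "?T frontier_of U"] by force
    \<comment> \<open>The basis came from \<open>d'\<close>, but its frontiers are empty and so have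
      dimension -1; hence it also serves for \<open>d\<close>.\<close>
    moreover have "- 1 \<le> d - 1" using 2 by (simp add: one_ereal_def)
    ultimately show ?thesis
      using \<U>(1) by (auto simp: tH_bounds_def hausdorff_dim_def intro!: exI[of _ \<U>])
  next
    case 3
    \<comment> \<open>These exponents exceed \<open>r - 1\<close> strictly, so some bound
      \<open>d'\<close> lies below \<open>s n + 1\<close>; they are positive even for
      \<open>r = 1\<close>, and they tend to \<open>r - 1\<close>.\<close>
    define s where "s n = r - 1 + inverse (real (Suc n))" for n
    have s: "0 < s n" for n using 3 by (simp add: s_def add_nonneg_pos)
    have "\<forall>n. \<exists>W :: nat \<Rightarrow> 'a set. (\<forall>k. open (W k)) \<and> hausdorff_measure (s n) (\<Inter>k. W k) = 0 \<and>
        topology_basis ?T {U. openin ?T U \<and> ?T frontier_of U \<subseteq> (\<Inter>k. W k)}"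
    proof
      fix n
      have "Inf (tH_bounds X) < ereal (s n + 1)" using 3 by (simp add: d_def s_def)
      then obtain d' where d': "d' \<in> tH_bounds X" "d' < ereal (s n + 1)"
        unfolding Inf_less_iff by blast
      then obtain \<U> where \<U>: "topology_basis ?T \<U>"
          "\<And>U. U \<in> \<U> \<Longrightarrow> hausdorff_dim (?T frontier_of U) \<le> d' - 1"
        by (auto simp: tH_bounds_def)
      have "d' - 1 < ereal (s n)" using d'(2) by (cases d') (auto simp: one_ereal_def)
      with \<U> s[of n] show "\<exists>W :: nat \<Rightarrow> 'a set. (\<forall>k. open (W k)) \<and>
          hausdorff_measure (s n) (\<Inter>k. W k) = 0 \<and>
          topology_basis ?T {U. openin ?T U \<and> ?T frontier_of U \<subseteq> (\<Inter>k. W k)}"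
        by (intro gdelta_containing_basis_frontiers[OF X \<U>(1)]) (auto intro: le_less_trans)
    qed
    from choice[OF this] obtain W :: "nat \<Rightarrow> nat \<Rightarrow> 'a set" where W: "\<And>n k. open (W n k)"
        "\<And>n. hausdorff_measure (s n) (\<Inter>k. W n k) = 0"
        "\<And>n. topology_basis ?T {U. openin ?T U \<and> ?T frontier_of U \<subseteq> (\<Inter>k. W n k)}"
      by blast
    \<comment> \<open>Such a set is null for every exponent \<open>s n\<close>, so its dimension is
      at most their limit.\<close>
    have "hausdorff_dim A \<le> d - 1" if A: "A \<subseteq> (\<Inter>n. \<Inter>k. W n k)" for A
    proof (rule LIMSEQ_le_const)
      have "s \<longlonglongrightarrow> r - 1" unfolding s_def by (rule LIMSEQ_inverse_real_of_nat_add)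
      then show "(\<lambda>n. ereal (s n)) \<longlonglongrightarrow> d - 1" using 3 by (simp add: one_ereal_def)
      have "hausdorff_measure (s n) A = 0" for n
        using A by (intro hausdorff_measure_null_mono[OF W(2)[of n]]) blast
      then show "\<exists>N. \<forall>n\<ge>N. hausdorff_dim A \<le> ereal (s n)"
        using hausdorff_dim_le s less_imp_le by blast
    qed
    with topology_basis_frontier_subset_INT[OF X W(1,3)] show ?thesis
      unfolding tH_bounds_def
      by (intro CollectI exI[of _ "{U. openin ?T U \<and> ?T frontier_of U \<subseteq> (\<Inter>n. \<Inter>k. W n k)}"]) simp
  qed
  moreover have "topological_hausdorff_dim X = d"
    using assms(1) by (simp add: topological_hausdorff_dim_def d_def)
  ultimately show ?thesis unfolding d_def by (auto intro: Inf_lower)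
qed

end
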